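(* Let $n\geq 2$ be an integer and let $D_{2n}=\langle x,y\mid x^n=y^2=1,\ yxy=x^{-1}\rangle$ be the dihedral group of order $2n$. Then $S(D_{2n})=|D_{2n}|$ if and only if $n$ is odd.
   Context: For a finite group $H$, let $\exp(H)$ denote the exponent of $H$ (the least positive integer $e$ with $a^e=1$ for all $a\in H$), let $o(a)$ denote the order of $a\in H$, and define $\varphi(H)=|\{a\in H \mid o(a)=\exp(H)\}|$. For a finite group $G$, define $S(G)=\sum_{H\leq G}\varphi(H)$, where the sum runs over all subgroups $H$ of $G$ (including the trivial subgroup and $G$ itself). For $n=2$, $D_4$ is the Klein four-group $\mathbb{Z}_2\times\mathbb{Z}_2$. *)

theory Defs
  imports "HOL-Algebra.Multiplicative_Group"
begin

section \<open>Group presentations\<close>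

text \<open>The generators of a presentation are all elements of the type \<open>'g\<close>.\<close>

datatype 'g letter = Gen 'g | Inv 'g

text \<open>The least congruence on words that contains the free cancellations and
  the relations \<open>l = r\<close> for \<open>(l, r) \<in> R\<close>.\<close>

inductive pres_eq :: "('g letter list \<times> 'g letter list) set \<Rightarrow> 'g letter list \<Rightarrow> 'g letter list \<Rightarrow> bool"
  for R where
  refl: "pres_eq R u u"
| sym: "pres_eq R u v \<Longrightarrow> pres_eq R v u"
| trans: "pres_eq R u v \<Longrightarrow> pres_eq R v w \<Longrightarrow> pres_eq R u w"
| cancel_right: "pres_eq R (u @ [Gen a, Inv a] @ v) (u @ v)"
| cancel_left: "pres_eq R (u @ [Inv a, Gen a] @ v) (u @ v)"
| relation: "(l, r) \<in> R \<Longrightarrow> pres_eq R (u @ l @ v) (u @ r @ v)"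

definition pres_class ::
  "('g letter list \<times> 'g letter list) set \<Rightarrow> 'g letter list \<Rightarrow> 'g letter list set" where
  "pres_class R u = {v. pres_eq R u v}"

definition presented_group ::
  "('g letter list \<times> 'g letter list) set \<Rightarrow> 'g letter list set monoid" where
  "presented_group R =
     \<lparr> carrier = range (pres_class R),
       mult = (\<lambda>A B. \<Union>u\<in>A. \<Union>v\<in>B. pres_class R (u @ v)),
       one = pres_class R [] \<rparr>"

lemma pres_class_eq_iff: "pres_class R u = pres_class R v \<longleftrightarrow> pres_eq R u v"
proof
  assume "pres_class R u = pres_class R v"
  moreover have "v \<in> pres_class R v" by (simp add: pres_class_def pres_eq.refl)
  ultimately have "v \<in> pres_class R u" by (simp only:)
  then show "pres_eq R u v" by (simp add: pres_class_def)
next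
  assume "pres_eq R u v"
  then have "pres_eq R u w \<longleftrightarrow> pres_eq R v w" for w
    using pres_eq.trans[of R u v w] pres_eq.trans[of R v u w] pres_eq.sym[of R u v] by argo
  then show "pres_class R u = pres_class R v"
    by (simp add: pres_class_def)
qed

lemma pres_eq_context: "pres_eq R u v \<Longrightarrow> pres_eq R (p @ u @ q) (p @ v @ q)"
proof (induction rule: pres_eq.induct)
  case (refl u)
  show ?case by (rule pres_eq.refl)
next
  case (sym u v)
  from sym.IH show ?case by (rule pres_eq.sym)
next
  case (trans u v w)
  from trans.IH show ?case by (rule pres_eq.trans)
next
  case (cancel_right u a v)
  then show ?case using pres_eq.cancel_right[of R "p @ u" a "v @ q"] by simp
next
  case (cancel_left u a v)
  then show ?case using pres_eq.cancel_left[of R "p @ u" a "v @ q"] by simp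
next
  case (relation l r u v)
  then show ?case using pres_eq.relation[of l r R "p @ u" "v @ q"] by simp
qed

lemma pres_eq_append:
  assumes "pres_eq R u u'" and "pres_eq R v v'"
  shows "pres_eq R (u @ v) (u' @ v')"
proof (rule pres_eq.trans)
  show "pres_eq R (u @ v) (u' @ v)" using pres_eq_context[OF assms(1), of "[]" v] by simp
  show "pres_eq R (u' @ v) (u' @ v')" using pres_eq_context[OF assms(2), of u' "[]"] by simp
qed

lemma presented_group_mult:
  "pres_class R u \<otimes>\<^bsub>presented_group R\<^esub> pres_class R v = pres_class R (u @ v)"
proof -
  have "pres_class R (u' @ v') = pres_class R (u @ v)"
    if "u' \<in> pres_class R u" and "v' \<in> pres_class R v" for u' v'
  proof -
    have "pres_eq R u u'" "pres_eq R v v'" using that by (simp_all add: pres_class_def)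
    then have "pres_eq R (u @ v) (u' @ v')" by (rule pres_eq_append)
    then show ?thesis by (simp add: pres_class_eq_iff pres_eq.sym)
  qed
  moreover have "u \<in> pres_class R u" "v \<in> pres_class R v"
    by (simp_all add: pres_class_def pres_eq.refl)
  ultimately have "(\<Union>u'\<in>pres_class R u. \<Union>v'\<in>pres_class R v. pres_class R (u' @ v'))
      = pres_class R (u @ v)"
    by blast
  then show ?thesis by (simp add: presented_group_def)
qed

lemma presented_group_carrier: "carrier (presented_group R) = range (pres_class R)"
  by (simp add: presented_group_def)

lemma presented_group_one: "\<one>\<^bsub>presented_group R\<^esub> = pres_class R []"
  by (simp add: presented_group_def)

lemma pres_left_inverse: "\<exists>v. pres_eq R (v @ u) []"
proof (induction u)
  case Nil
  show ?case by (rule exI[of _ "[]"]) (simp add: pres_eq.refl)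
next
  case (Cons x u)
  then obtain v where v: "pres_eq R (v @ u) []" by blast
  have "\<exists>y. pres_eq R (v @ [y, x] @ u) (v @ u)"
  proof (cases x)
    case (Gen a)
    then show ?thesis using pres_eq.cancel_left[of R v a u] by blast
  next
    case (Inv a)
    then show ?thesis using pres_eq.cancel_right[of R v a u] by blast
  qed
  then obtain y where "pres_eq R (v @ [y, x] @ u) (v @ u)" by blast
  from pres_eq.trans[OF this v] have "pres_eq R ((v @ [y]) @ x # u) []" by simp
  then show ?case by blast
qed

lemma presented_group_is_group: "group (presented_group R)"
proof (rule groupI)
  fix A assume "A \<in> carrier (presented_group R)"
  then obtain u where u: "A = pres_class R u" by (auto simp: presented_group_carrier)
  obtain v where "pres_eq R (v @ u) []" using pres_left_inverse by blast
  then show "\<exists>B\<in>carrier (presented_group R).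
      B \<otimes>\<^bsub>presented_group R\<^esub> A = \<one>\<^bsub>presented_group R\<^esub>"
    by (intro bexI[of _ "pres_class R v"])
       (simp_all add: u presented_group_carrier presented_group_mult presented_group_one
          pres_class_eq_iff rangeI)
qed (auto simp: presented_group_carrier presented_group_mult presented_group_one)


section \<open>The dihedral group\<close>

datatype dihedral_gen = X | Y

text \<open>The group \<open>\<langle>x, y | x\<^sup>n = y\<^sup>2 = 1, y x y = x\<^sup>-\<^sup>1\<rangle>\<close>; note that the argument is
  half the order of the group.\<close>

definition dihedral_group :: "nat \<Rightarrow> dihedral_gen letter list set monoid" where
  "dihedral_group n = presented_group
     {(replicate n (Gen X), []),
      ([Gen Y, Gen Y], []),
      ([Gen Y, Gen X, Gen Y], [Inv X])}"


section \<open>Exponent and the sum over subgroups\<close>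

text \<open>The definitions below are meant for finite groups: for infinite ones, \<open>card\<close>, \<open>sum\<close>
  and \<open>LEAST\<close> need not be meaningful.\<close>

definition group_exponent :: "('a, 'b) monoid_scheme \<Rightarrow> nat" where
  "group_exponent H = (LEAST e. 0 < e \<and> (\<forall>a\<in>carrier H. a [^]\<^bsub>H\<^esub> e = \<one>\<^bsub>H\<^esub>))"

definition phi :: "('a, 'b) monoid_scheme \<Rightarrow> nat" where
  "phi H = card {a \<in> carrier H. group.ord H a = group_exponent H}"

definition subgroup_phi_sum :: "('a, 'b) monoid_scheme \<Rightarrow> nat" where
  "subgroup_phi_sum G = (\<Sum>H | subgroup H G. phi (G\<lparr>carrier := H\<rparr>))"

end

theory Submission
  imports Defs
begin

text \<open>Each element \<open>a\<close> of a finite group generates a cyclic subgroup whose exponent is the order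
  of \<open>a\<close>, and these pairs \<open>(\<langle>a\<rangle>, a)\<close> contribute exactly \<open>|G|\<close> to the sum. So equality holds iff
  every subgroup having an element whose order is its exponent is generated by that element. In
  the dihedral group with \<open>n\<close> even this fails for the Klein four-group generated by \<open>x\<close> to the
  power \<open>n / 2\<close> and \<open>y\<close>. For \<open>n\<close> odd, the rotation subgroup is cyclic, and in a subgroup
  containing a reflection an element of order equal to the (even) exponent must itself be a
  reflection, so the exponent is \<open>2\<close>, there are no nontrivial rotations, and the subgroup has
  order \<open>2\<close>.\<close>

section \<open>Exponents and the counting criterion in finite groups\<close>

lemma group_exponent_pow:
  assumes "group G" "finite (carrier G)"
  shows "0 < group_exponent G"
    and "\<And>a. a \<in> carrier G \<Longrightarrow> a [^]\<^bsub>G\<^esub> group_exponent G = \<one>\<^bsub>G\<^esub>"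
proof -
  interpret group G by fact
  \<comment> \<open>By Lagrange the group order is a witness, so the \<open>LEAST\<close> in the
    exponent is attained.\<close>
  have "0 < order G \<and> (\<forall>a\<in>carrier G. a [^]\<^bsub>G\<^esub> order G = \<one>\<^bsub>G\<^esub>)"
    using assms(2) pow_order_eq_1 order_gt_0_iff_finite by blast
  from LeastI[of "\<lambda>e. 0 < e \<and> (\<forall>a\<in>carrier G. a [^]\<^bsub>G\<^esub> e = \<one>\<^bsub>G\<^esub>)", OF this]
  show "0 < group_exponent G"
    and "\<And>a. a \<in> carrier G \<Longrightarrow> a [^]\<^bsub>G\<^esub> group_exponent G = \<one>\<^bsub>G\<^esub>"
    unfolding group_exponent_def by blast+
qed

text \<open>Replaces the \<open>LEAST\<close> by a condition on powers: \<open>ord a\<close> always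
  divides the exponent, so as soon as it annihilates the whole group, minimality forces
  equality.\<close>

lemma (in group) ord_eq_group_exponent_iff:
  assumes "finite (carrier G)" "a \<in> carrier G"
  shows "ord a = group_exponent G \<longleftrightarrow> (\<forall>b\<in>carrier G. b [^] ord a = \<one>)"
proof
  assume "ord a = group_exponent G"
  then show "\<forall>b\<in>carrier G. b [^] ord a = \<one>"
    using group_exponent_pow(2)[OF is_group assms(1)] by simp
next
  assume all: "\<forall>b\<in>carrier G. b [^] ord a = \<one>"
  have "ord a > 0" using ord_ge_1[OF assms] by simp
  with all have "group_exponent G \<le> ord a"
    unfolding group_exponent_def by (intro Least_le) blast
  moreover have "ord a dvd group_exponent G"
    using group_exponent_pow(2)[OF is_group assms(1) assms(2)] assms(2) by (simp add: pow_eq_id)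
  ultimately show "ord a = group_exponent G"
    using group_exponent_pow(1)[OF is_group assms(1)] by (simp add: dvd_imp_le le_antisym)
qed

lemma (in group) ord_subgroup:
  assumes "subgroup H G"
  shows "group.ord (G\<lparr>carrier := H\<rparr>) a = ord a"
proof -
  interpret H: group "G\<lparr>carrier := H\<rparr>" by (rule subgroup_imp_group[OF assms])
  show ?thesis by (simp add: H.ord_def ord_def nat_pow_consistent[symmetric])
qed

lemma (in group) phi_subgroup:
  assumes "finite (carrier G)" "subgroup H G"
  shows "phi (G\<lparr>carrier := H\<rparr>) = card {a \<in> H. \<forall>b\<in>H. b [^] ord a = \<one>}"
proof -
  interpret H: group "G\<lparr>carrier := H\<rparr>" by (rule subgroup_imp_group[OF assms(2)])
  have "finite H" using assms subgroup.subset finite_subset by blast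
  then have "{a \<in> H. group.ord (G\<lparr>carrier := H\<rparr>) a = group_exponent (G\<lparr>carrier := H\<rparr>)}
      = {a \<in> H. \<forall>b\<in>H. b [^] ord a = \<one>}"
    using H.ord_eq_group_exponent_iff by (auto simp: ord_subgroup[OF assms(2)] nat_pow_consistent[symmetric])
  then show ?thesis by (simp add: phi_def)
qed

text \<open>Only one inclusion has to be stated on the right, since \<open>a \<in> H\<close> already
  puts the subgroup generated by \<open>a\<close> inside \<open>H\<close>.\<close>

lemma (in group) subgroup_phi_sum_eq_order_iff:
  assumes fin: "finite (carrier G)"
  shows "subgroup_phi_sum G = order G \<longleftrightarrow>
    (\<forall>H a. subgroup H G \<longrightarrow> a \<in> H \<longrightarrow> (\<forall>b\<in>H. b [^] ord a = \<one>) \<longrightarrow> H \<subseteq> generate G {a})"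
    (is "_ \<longleftrightarrow> ?cyc")
proof -
  define P where
    \<comment> \<open>The sum becomes the size of a set of pairs, so comparing it with
      \<open>order G\<close> reduces to an inclusion of finite sets.\<close>
    "P = (SIGMA H : {H. subgroup H G}. {a \<in> H. \<forall>b\<in>H. b [^] ord a = \<one>})"
  define Q where "Q = (\<lambda>a. (generate G {a}, a)) ` carrier G"
  have finS: "finite {H. subgroup H G}"
    by (rule finite_subset[of _ "Pow (carrier G)"]) (auto simp: fin dest: subgroup.mem_carrier)
  have finH: "finite H" if "subgroup H G" for H
    using that fin subgroup.subset finite_subset by blast
  have P: "subgroup_phi_sum G = card P"
    unfolding subgroup_phi_sum_def P_def
    using finS finH by (simp add: phi_subgroup[OF fin])
  have finP: "finite P"
    unfolding P_def using finS finH by auto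
  \<comment> \<open>Keeping \<open>a\<close> as second component makes the map injective, although
    different elements may generate the same subgroup.\<close>
  have Q: "card Q = order G"
    unfolding Q_def order_def by (rule card_image) (auto intro: inj_onI)
  have pow: "b [^] ord a = \<one>" if a: "a \<in> carrier G" and b: "b \<in> generate G {a}" for a b
  proof -
    obtain k :: nat where "b = a [^] k"
      using b unfolding generate_pow_on_finite_carrier[OF fin a] by auto
    then have "b [^] ord a = (a [^] ord a) [^] k"
      using a by (simp only: nat_pow_pow mult.commute)
    then show ?thesis using a by simp
  qed
  have QP: "Q \<subseteq> P"
    unfolding Q_def P_def using pow by (auto simp: generate_is_subgroup intro: generate.incl)
  have "subgroup_phi_sum G = order G \<longleftrightarrow> P \<subseteq> Q"
    using P Q QP finP card_subset_eq[of P Q] by auto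
  also have "\<dots> \<longleftrightarrow> ?cyc"
  proof
    assume "P \<subseteq> Q"
    then show ?cyc unfolding P_def Q_def by blast
  next
    assume cyc: ?cyc
    have "H = generate G {a}" if "subgroup H G" "a \<in> H" "\<forall>b\<in>H. b [^] ord a = \<one>" for H a
      using that cyc generate_subgroup_incl[of "{a}" H] by blast
    then show "P \<subseteq> Q" unfolding P_def Q_def by (auto dest: subgroup.mem_carrier)
  qed
  finally show ?thesis .
qed

section \<open>Powers of one element, and the odd case from the dihedral relations\<close>

lemma (in group) ord_eq_2:
  assumes "x \<in> carrier G" "x \<otimes> x = \<one>" "x \<noteq> \<one>"
  shows "ord x = 2"
proof -
  have "ord x dvd 2"
    using assms(1,2) pow_eq_id[of x 2] by (simp add: numeral_2_eq_2)
  moreover have "ord x \<noteq> 1" using assms ord_eq_1 by blast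
  ultimately show ?thesis
    using dvd_imp_le[of "ord x" 2] by (cases "ord x = 0") auto
qed

text \<open>With \<open>N\<close> the order of \<open>x\<close> and \<open>g = gcd N j\<close>, the
  order of \<open>x [^] j\<close> divides \<open>N / g\<close>. Hence \<open>x [^] k\<close> is
  killed by \<open>N / g\<close>, which forces \<open>g\<close> to divide \<open>k\<close>, and
  Bezout writes \<open>k\<close> as a multiple of \<open>j\<close> modulo \<open>N\<close>.\<close>

lemma (in group) int_pow_mem_generate:
  fixes j k :: int
  assumes x: "x \<in> carrier G" "ord x \<noteq> 0"
    and pow: "(x [^] k) [^] ord (x [^] j) = \<one>"
  shows "x [^] k \<in> generate G {x [^] j}"
proof -
  define N where "N = int (ord x)"
  define g where "g = gcd N j"
  have N: "N > 0" using x(2) by (simp add: N_def)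
  then have g: "g > 0" by (simp add: g_def)
  obtain e where e: "N = g * e" unfolding g_def by (meson dvdE gcd_dvd1)
  obtain f where f: "j = g * f" unfolding g_def by (meson dvdE gcd_dvd2)
  have "x [^] (j * e) = \<one>"
    using x(1) by (simp add: int_pow_eq_id e f N_def[symmetric])
  then have "(x [^] j) [^] e = \<one>" using x(1) by (simp add: int_pow_pow)
  then have "int (ord (x [^] j)) dvd e" using x(1) by (simp add: int_pow_eq_id)
  moreover have "int (ord (x [^] k)) dvd int (ord (x [^] j))"
    using pow x(1) by (simp add: pow_eq_id)
  ultimately have "(x [^] k) [^] e = \<one>"
    using x(1) int_pow_eq_id[of "x [^] k" e] dvd_trans by auto
  then have "N dvd k * e"
    using x(1) by (simp add: int_pow_pow int_pow_eq_id N_def)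
  then have "g dvd k" using e N by auto
  then obtain c where c: "k = g * c" by blast
  obtain u v where uv: "u * N + v * j = g" using bezout_int[of N j] g_def by metis
  have "k = N * (u * c) + j * (v * c)"
    unfolding c uv[symmetric] by (simp add: algebra_simps)
  then have "x [^] k = x [^] (N * (u * c) + j * (v * c))" by (rule arg_cong)
  also have "\<dots> = (x [^] j) [^] (v * c)"
    using x(1) int_pow_eq_id[OF x(1), of "N * (u * c)"]
    by (simp add: int_pow_mult int_pow_pow N_def)
  finally show ?thesis using generate_pow[of "x [^] j"] x(1) by auto
qed

text \<open>As \<open>y\<close> is its own inverse, the map sending \<open>g\<close> to
  \<open>y \<otimes> g \<otimes> y\<close> is an endomorphism, so its value on \<open>x\<close>
  determines it on all powers.\<close>

lemma (in group) conj_int_pow: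
  fixes k :: int
  assumes [simp]: "x \<in> carrier G" "y \<in> carrier G"
    and y: "y \<otimes> y = \<one>" and yxy: "y \<otimes> x \<otimes> y = inv x"
  shows "y \<otimes> x [^] k \<otimes> y = x [^] (- k)"
proof -
  have "(\<lambda>g. y \<otimes> g \<otimes> y) \<in> hom G G"
  proof (rule homI)
    fix g h assume [simp]: "g \<in> carrier G" "h \<in> carrier G"
    have "y \<otimes> g \<otimes> y \<otimes> (y \<otimes> h \<otimes> y) = y \<otimes> g \<otimes> (y \<otimes> y) \<otimes> h \<otimes> y"
      by (simp add: m_assoc)
    then show "y \<otimes> (g \<otimes> h) \<otimes> y = y \<otimes> g \<otimes> y \<otimes> (y \<otimes> h \<otimes> y)"
      by (simp add: y m_assoc)
  qed simp
  then interpret h: group_hom G G "\<lambda>g. y \<otimes> g \<otimes> y" by unfold_locales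
  show ?thesis using h.hom_int_pow[of x k] by (simp add: yxy int_pow_inv int_pow_neg)
qed

text \<open>Formulated for any finite group with the dihedral relations and a normal form, which
  keeps words out of the subgroup analysis.\<close>

lemma (in group) dihedral_odd_subgroup_phi_sum:
  fixes n :: nat
  assumes fin: "finite (carrier G)" and x[simp]: "x \<in> carrier G" and [simp]: "y \<in> carrier G"
    and xn: "x [^] n = \<one>" and n: "odd n"
    and y: "y \<otimes> y = \<one>" and yxy: "y \<otimes> x \<otimes> y = inv x"
    and gen: "\<And>g. g \<in> carrier G \<Longrightarrow> \<exists>k::int. g = x [^] k \<or> g = x [^] k \<otimes> y"
  shows "subgroup_phi_sum G = order G"
  unfolding subgroup_phi_sum_eq_order_iff[OF fin]
proof (intro allI impI subsetI)
  fix H a b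
  assume H: "subgroup H G" and a: "a \<in> H" and pow: "\<forall>b\<in>H. b [^] ord a = \<one>" and b: "b \<in> H"
  have [simp]: "a \<in> carrier G" "b \<in> carrier G" using H a b by (auto dest: subgroup.mem_carrier)
  \<comment> \<open>Two reflections multiply to a rotation; \<open>i = j\<close> shows that every
    reflection squares to the identity.\<close>
  have refl_mult: "(x [^] i \<otimes> y) \<otimes> (x [^] j \<otimes> y) = x [^] (i - j)" for i j :: int
  proof -
    have "(x [^] i \<otimes> y) \<otimes> (x [^] j \<otimes> y) = x [^] i \<otimes> (y \<otimes> x [^] j \<otimes> y)"
      by (simp add: m_assoc)
    also have "\<dots> = x [^] (i + - j)"
      by (simp add: conj_int_pow[OF _ _ y yxy] flip: int_pow_mult)
    finally show ?thesis by simp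
  qed
  have odd_ord: "odd (ord (x [^] i))" for i :: int
  proof -
    have "(x [^] i) [^] n = x [^] (int n * i)"
      by (simp add: int_pow_pow mult.commute flip: int_pow_int)
    also have "\<dots> = \<one>" using xn by (simp add: int_pow_pow int_pow_int flip: int_pow_pow)
    finally have "ord (x [^] i) dvd n" by (simp add: pow_eq_id)
    with n show ?thesis by auto
  qed
  have ord_x: "ord x \<noteq> 0" using ord_ge_1[OF fin x] by simp
  show "b \<in> generate G {a}"
  proof (cases "\<exists>c\<in>H. \<nexists>k::int. c = x [^] k")
    case False
    then obtain j k :: int where "a = x [^] j" "b = x [^] k" using a b by meson
    then show ?thesis using int_pow_mem_generate[OF x ord_x, of k j] pow b by simp
  next
    \<comment> \<open>The element \<open>c\<close> is a reflection of order 2, so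
      \<open>ord a\<close> is even; rotations have odd order, hence \<open>a\<close> is a reflection
      too.\<close>
    case True
    then obtain c k where c: "c \<in> H" "c = x [^] (k::int) \<otimes> y" "\<nexists>k::int. c = x [^] k"
      using gen H by (metis subgroup.mem_carrier)
    have [simp]: "c \<in> carrier G" using c H by (auto dest: subgroup.mem_carrier)
    have "c \<noteq> \<one>" using c(3) int_pow_0 by metis
    then have "ord c = 2" using refl_mult[of k k] c(2) by (intro ord_eq_2) simp_all
    then have even_a: "even (ord a)" using pow c(1) pow_eq_id[of c "ord a"] by simp
    then obtain j where j: "a = x [^] (j::int) \<otimes> y" using gen[of a] odd_ord by auto
    \<comment> \<open>A rotation in \<open>H\<close> is killed by \<open>ord a = 2\<close> but has
      odd order, so it is trivial.\<close>
    have rot: "x [^] i = \<one>" if "x [^] i \<in> H" for i :: int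
    proof -
      have "a \<noteq> \<one>" using even_a by auto
      then have "ord a = 2" using refl_mult[of j j] j by (intro ord_eq_2) simp_all
      with pow that have "x [^] i \<otimes> x [^] i = \<one>" by (fastforce simp: numeral_2_eq_2)
      then show ?thesis using ord_eq_2[of "x [^] i"] odd_ord[of i] x by (metis even_numeral int_pow_closed)
    qed
    consider i :: int where "b = x [^] i" | i :: int where "b = x [^] i \<otimes> y" using gen[of b] by auto
    then show ?thesis
    proof cases
      case 1
      then show ?thesis using rot b generate.one by metis
    next
      case 2
      \<comment> \<open>The rotation \<open>b \<otimes> a\<close> lies in \<open>H\<close>, so it is
        trivial, and cancelling \<open>a\<close> gives \<open>b = a\<close>.\<close>
      have ba: "b \<otimes> a = x [^] (i - j)" "a \<otimes> a = \<one>"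
        using refl_mult[of i j] refl_mult[of j j] 2 j by simp_all
      then have "b \<otimes> a = a \<otimes> a" using rot subgroup.m_closed[OF H b a] by metis
      then have "b = a" by simp
      then show ?thesis by (simp add: generate.incl)
    qed
  qed
qed

section \<open>Normal form and finiteness of the presented dihedral group\<close>

abbreviation dihedral_rels :: "nat \<Rightarrow> (dihedral_gen letter list \<times> dihedral_gen letter list) set" where
  "dihedral_rels n \<equiv> {(replicate n (Gen X), []), ([Gen Y, Gen Y], []), ([Gen Y, Gen X, Gen Y], [Inv X])}"

abbreviation dihedral_elt :: "nat \<Rightarrow> dihedral_gen letter list \<Rightarrow> dihedral_gen letter list set" where
  "dihedral_elt n \<equiv> pres_class (dihedral_rels n)"

lemma group_dihedral: "group (dihedral_group n)"
  by (simp add: dihedral_group_def presented_group_is_group)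

lemma dihedral_carrier: "carrier (dihedral_group n) = range (dihedral_elt n)"
  by (simp add: dihedral_group_def presented_group_carrier)

lemma dihedral_mult:
  "dihedral_elt n u \<otimes>\<^bsub>dihedral_group n\<^esub> dihedral_elt n v = dihedral_elt n (u @ v)"
  by (simp add: dihedral_group_def presented_group_mult)

lemma dihedral_one: "\<one>\<^bsub>dihedral_group n\<^esub> = dihedral_elt n []"
  by (simp add: dihedral_group_def presented_group_one)

lemma dihedral_relation:
  assumes "(l, r) \<in> dihedral_rels n"
  shows "dihedral_elt n l = dihedral_elt n r"
  using pres_eq.relation[OF assms, of "[]" "[]"] by (simp add: pres_class_eq_iff)

lemma dihedral_inv:
  "dihedral_elt n [Inv s] = inv\<^bsub>dihedral_group n\<^esub> dihedral_elt n [Gen s]"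
proof -
  interpret group "dihedral_group n" by (rule group_dihedral)
  have "dihedral_elt n [Inv s, Gen s] = dihedral_elt n []"
    using pres_eq.cancel_left[of "dihedral_rels n" "[]" s "[]"] by (simp add: pres_class_eq_iff)
  then show ?thesis
    by (intro inv_equality[symmetric]) (simp_all add: dihedral_carrier dihedral_mult dihedral_one)
qed

lemma dihedral_X_pow:
  "dihedral_elt n [Gen X] [^]\<^bsub>dihedral_group n\<^esub> k = dihedral_elt n (replicate k (Gen X))"
proof -
  interpret group "dihedral_group n" by (rule group_dihedral)
  show ?thesis
    by (induction k) (simp_all add: dihedral_mult dihedral_one replicate_append_same)
qed

lemma dihedral_YY:
  "dihedral_elt n [Gen Y] \<otimes>\<^bsub>dihedral_group n\<^esub> dihedral_elt n [Gen Y] = \<one>\<^bsub>dihedral_group n\<^esub>"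
  using dihedral_relation[of "[Gen Y, Gen Y]" "[]" n] by (simp add: dihedral_mult dihedral_one)

lemma dihedral_YXY:
  "dihedral_elt n [Gen Y] \<otimes>\<^bsub>dihedral_group n\<^esub> dihedral_elt n [Gen X]
     \<otimes>\<^bsub>dihedral_group n\<^esub> dihedral_elt n [Gen Y]
   = inv\<^bsub>dihedral_group n\<^esub> dihedral_elt n [Gen X]"
  using dihedral_relation[of "[Gen Y, Gen X, Gen Y]" "[Inv X]" n]
  by (simp add: dihedral_mult dihedral_inv)

lemma dihedral_X_pow_n:
  "dihedral_elt n [Gen X] [^]\<^bsub>dihedral_group n\<^esub> n = \<one>\<^bsub>dihedral_group n\<^esub>"
  using dihedral_relation[of "replicate n (Gen X)" "[]" n] by (simp add: dihedral_X_pow dihedral_one)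

text \<open>Induction on a representing word: each letter is a power of \<open>x\<close> or equals
  \<open>y\<close>, and left multiplication by either preserves the two shapes.\<close>

lemma dihedral_normal_form:
  assumes "g \<in> carrier (dihedral_group n)"
  shows "\<exists>k::int. g = dihedral_elt n [Gen X] [^]\<^bsub>dihedral_group n\<^esub> k \<or>
    g = dihedral_elt n [Gen X] [^]\<^bsub>dihedral_group n\<^esub> k \<otimes>\<^bsub>dihedral_group n\<^esub> dihedral_elt n [Gen Y]"
proof -
  interpret group "dihedral_group n" by (rule group_dihedral)
  let ?G = "dihedral_group n"
  define x where "x = dihedral_elt n [Gen X]"
  define y where "y = dihedral_elt n [Gen Y]"
  have [simp]: "x \<in> carrier ?G" "y \<in> carrier ?G" by (simp_all add: x_def y_def dihedral_carrier)
  have yy: "y \<otimes>\<^bsub>?G\<^esub> y = \<one>\<^bsub>?G\<^esub>" by (simp add: y_def dihedral_YY)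
  have inv_y: "inv\<^bsub>?G\<^esub> y = y" using yy by (simp add: inv_equality)
  have "y \<otimes>\<^bsub>?G\<^esub> x \<otimes>\<^bsub>?G\<^esub> y = inv\<^bsub>?G\<^esub> x" by (simp add: x_def y_def dihedral_YXY)
  then have conj: "y \<otimes>\<^bsub>?G\<^esub> x [^]\<^bsub>?G\<^esub> k \<otimes>\<^bsub>?G\<^esub> y = x [^]\<^bsub>?G\<^esub> (- k)" for k :: int
    using conj_int_pow yy by simp
  \<comment> \<open>Moving \<open>y\<close> to the right past a rotation inverts the
    rotation.\<close>
  have y_left: "y \<otimes>\<^bsub>?G\<^esub> x [^]\<^bsub>?G\<^esub> k = x [^]\<^bsub>?G\<^esub> (- k) \<otimes>\<^bsub>?G\<^esub> y" for k :: int
    by (simp add: m_assoc yy flip: conj)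
  have step: "\<exists>k::int. s \<otimes>\<^bsub>?G\<^esub> h = x [^]\<^bsub>?G\<^esub> k \<or> s \<otimes>\<^bsub>?G\<^esub> h = x [^]\<^bsub>?G\<^esub> k \<otimes>\<^bsub>?G\<^esub> y"
    if s: "s = x [^]\<^bsub>?G\<^esub> (i::int) \<or> s = y" and h: "h = x [^]\<^bsub>?G\<^esub> (j::int) \<or> h = x [^]\<^bsub>?G\<^esub> j \<otimes>\<^bsub>?G\<^esub> y" for s h i j
    using s
  proof
    assume "s = x [^]\<^bsub>?G\<^esub> i"
    with h show ?thesis
      by (intro exI[of _ "i + j"]) (auto simp: int_pow_mult m_assoc)
  next
    assume "s = y"
    with h show ?thesis
      by (intro exI[of _ "- j"]) (auto simp: y_left m_assoc yy simp flip: m_assoc[of y])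
  qed
  have "\<exists>k::int. dihedral_elt n w = x [^]\<^bsub>?G\<^esub> k \<or> dihedral_elt n w = x [^]\<^bsub>?G\<^esub> k \<otimes>\<^bsub>?G\<^esub> y" for w
  proof (induction w)
    case Nil
    show ?case by (rule exI[of _ 0]) (simp add: dihedral_one)
  next
    case (Cons s w)
    then obtain j :: int
      where j: "dihedral_elt n w = x [^]\<^bsub>?G\<^esub> j \<or> dihedral_elt n w = x [^]\<^bsub>?G\<^esub> j \<otimes>\<^bsub>?G\<^esub> y" ..
    have "\<exists>i::int. dihedral_elt n [s] = x [^]\<^bsub>?G\<^esub> i \<or> dihedral_elt n [s] = y"
    proof (cases s)
      case (Gen a)
      then show ?thesis
        by (cases a) (auto simp: x_def[symmetric] y_def[symmetric] intro: exI[of _ 1])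
    next
      case (Inv a)
      then show ?thesis
        by (cases a) (auto simp: dihedral_inv x_def[symmetric] y_def[symmetric] inv_y int_pow_neg
            intro: exI[of _ "- 1"])
    qed
    then obtain i :: int where "dihedral_elt n [s] = x [^]\<^bsub>?G\<^esub> i \<or> dihedral_elt n [s] = y" ..
    from step[OF this j] show ?case by (simp add: dihedral_mult)
  qed
  then show ?thesis using assms by (auto simp: dihedral_carrier x_def y_def)
qed

text \<open>Exponents in the normal form can be reduced modulo \<open>n\<close>, leaving at most
  \<open>n\<close> rotations and \<open>n\<close> reflections.\<close>

lemma finite_dihedral:
  assumes "n > 0"
  shows "finite (carrier (dihedral_group n))"
proof -
  interpret group "dihedral_group n" by (rule group_dihedral)
  let ?G = "dihedral_group n"
  let ?x = "dihedral_elt n [Gen X]" and ?y = "dihedral_elt n [Gen Y]"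
  have x: "?x \<in> carrier ?G" by (simp add: dihedral_carrier)
  have "?x [^]\<^bsub>?G\<^esub> k \<in> (\<lambda>i. ?x [^]\<^bsub>?G\<^esub> i) ` {0..<int n}" for k :: int
  proof
    have "int (ord ?x) dvd int n"
      using dihedral_X_pow_n[of n] x pow_eq_id by simp
    then show "?x [^]\<^bsub>?G\<^esub> k = ?x [^]\<^bsub>?G\<^esub> (k mod int n)"
      using dvd_trans[OF _ dvd_minus_mod[of "int n" k]] by (simp add: int_pow_eq[OF x] dvd_diff_commute)
  qed (use assms in simp)
  moreover define R where "R = (\<lambda>i. ?x [^]\<^bsub>?G\<^esub> i) ` {0..<int n}"
  ultimately have rot: "?x [^]\<^bsub>?G\<^esub> k \<in> R" for k :: int by simp
  have "carrier ?G \<subseteq> R \<union> (\<lambda>g. g \<otimes>\<^bsub>?G\<^esub> ?y) ` R"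
  proof
    fix g assume "g \<in> carrier ?G"
    then obtain k :: int
      where "g = ?x [^]\<^bsub>?G\<^esub> k \<or> g = ?x [^]\<^bsub>?G\<^esub> k \<otimes>\<^bsub>?G\<^esub> ?y"
      by (rule exE[OF dihedral_normal_form])
    then show "g \<in> R \<union> (\<lambda>g. g \<otimes>\<^bsub>?G\<^esub> ?y) ` R"
      using rot[of k] imageI[OF rot[of k], of "\<lambda>g. g \<otimes>\<^bsub>?G\<^esub> ?y"]
      by (elim disjE) simp_all
  qed
  moreover have "finite R" by (simp add: R_def)
  ultimately show ?thesis using finite_subset by blast
qed

text \<open>The action on the vertices of an \<open>n\<close>-gon, lifted from the residues modulo \<open>n\<close> to the
  integers so that it is defined on words without reference to \<open>n\<close>.\<close>

fun letter_act :: "dihedral_gen letter \<Rightarrow> int \<Rightarrow> int" where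
  "letter_act (Gen X) k = k + 1"
| "letter_act (Inv X) k = k - 1"
| "letter_act (Gen Y) k = - k"
| "letter_act (Inv Y) k = - k"

definition word_act :: "dihedral_gen letter list \<Rightarrow> int \<Rightarrow> int" where
  "word_act w k = foldr letter_act w k"

lemma word_act_simps [simp]:
  "word_act [] k = k" "word_act (s # w) k = letter_act s (word_act w k)"
  "word_act (u @ v) k = word_act u (word_act v k)"
  by (simp_all add: word_act_def)

lemma word_act_replicate_X [simp]: "word_act (replicate m (Gen X)) k = k + int m"
  by (induction m) simp_all

text \<open>Each letter shifts or negates, so it respects congruence modulo \<open>n\<close>. This
  carries a relation through the word to its left.\<close>

lemma word_act_cong:
  assumes "int n dvd j - k"
  shows "int n dvd word_act w j - word_act w k"
proof (induction w)
  case (Cons s w)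
  show ?case
  proof (cases s)
    case (Gen a)
    then show ?thesis
      using Cons by (cases a) (simp_all add: dvd_diff_commute)
  next
    case (Inv a)
    then show ?thesis
      using Cons by (cases a) (simp_all add: dvd_diff_commute)
  qed
qed (simp add: assms)

text \<open>The action descends to the presented group modulo \<open>n\<close>, which serves to
  bound the order of \<open>x\<close> from below.\<close>

lemma word_act_pres_eq:
  assumes "pres_eq (dihedral_rels n) u v"
  shows "int n dvd word_act u k - word_act v k"
  using assms
proof (induction arbitrary: k rule: pres_eq.induct)
  case (sym u v)
  then show ?case by (simp add: dvd_diff_commute)
next
  case (trans u v w)
  from dvd_add[OF trans.IH(1)[of k] trans.IH(2)[of k]] show ?case by simp
next
  case (cancel_right u a v)
  show ?case by (cases a) simp_all
next
  case (cancel_left u a v)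
  show ?case by (cases a) simp_all
next
  \<comment> \<open>Only the relator \<open>replicate n (Gen X)\<close> changes an integer, by
    \<open>n\<close>; the other two relations hold exactly.\<close>
  case (relation l r u v)
  then have "int n dvd word_act l j - word_act r j" for j
    by auto
  then show ?case by (simp add: word_act_cong)
qed simp

fun is_Y :: "dihedral_gen letter \<Rightarrow> bool" where
  "is_Y (Gen a) = (a = Y)"
| "is_Y (Inv a) = (a = Y)"

text \<open>Both cancellations and all relations change the number of \<open>Y\<close> letters by 0
  or 2. This parity separates reflections from rotations.\<close>

lemma pres_eq_parity_Y:
  assumes "pres_eq (dihedral_rels n) u v"
  shows "even (length (filter is_Y u)) = even (length (filter is_Y v))"
  using assms
proof (induction rule: pres_eq.induct)
  case (relation l r u v)
  then show ?case by (auto simp: filter_empty_conv)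
qed auto

section \<open>The even case: a Klein four-subgroup\<close>

lemma dihedral_even_subgroup_phi_sum:
  assumes "n > 0" "even n"
  shows "subgroup_phi_sum (dihedral_group n) \<noteq> order (dihedral_group n)"
proof
  assume eq: "subgroup_phi_sum (dihedral_group n) = order (dihedral_group n)"
  interpret group "dihedral_group n" by (rule group_dihedral)
  let ?G = "dihedral_group n"
  obtain m where m: "n = 2 * m" using assms(2) by blast
  define z where "z = dihedral_elt n (replicate m (Gen X))"
  define y where "y = dihedral_elt n [Gen Y]"
  have [simp]: "z \<in> carrier ?G" "y \<in> carrier ?G" by (simp_all add: z_def y_def dihedral_carrier)
  have z1: "z \<noteq> \<one>\<^bsub>?G\<^esub>"
  proof
    assume "z = \<one>\<^bsub>?G\<^esub>"
    then have "pres_eq (dihedral_rels n) (replicate m (Gen X)) []"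
      by (simp add: z_def dihedral_one pres_class_eq_iff)
    \<comment> \<open>Half a turn sends vertex 0 to \<open>m\<close>, and
      \<open>0 < m < n\<close>.\<close>
    from word_act_pres_eq[OF this, of 0] have "n dvd m" by simp
    then show False using assms m by (auto dest: dvd_imp_le)
  qed
  have zy: "z \<noteq> y"
    using pres_eq_parity_Y[of n "replicate m (Gen X)" "[Gen Y]"]
    by (auto simp: z_def y_def pres_class_eq_iff)
  have y1: "y \<noteq> \<one>\<^bsub>?G\<^esub>"
    using pres_eq_parity_Y[of n "[Gen Y]" "[]"] by (auto simp: y_def dihedral_one pres_class_eq_iff)
  have yy: "y \<otimes>\<^bsub>?G\<^esub> y = \<one>\<^bsub>?G\<^esub>" by (simp add: y_def dihedral_YY)
  have "replicate m (Gen X) @ replicate m (Gen X) = replicate n (Gen X)"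
    by (simp add: m mult_2 replicate_add)
  then have zz: "z \<otimes>\<^bsub>?G\<^esub> z = \<one>\<^bsub>?G\<^esub>"
    using dihedral_X_pow_n[of n] by (simp add: z_def dihedral_mult dihedral_X_pow)
  have inv_y: "inv\<^bsub>?G\<^esub> y = y" and inv_z: "inv\<^bsub>?G\<^esub> z = z" using yy zz by (simp_all add: inv_equality)
  \<comment> \<open>Conjugation by \<open>y\<close> inverts the involution \<open>z\<close>, hence
    fixes it, so the two commute.\<close>
  have "y \<otimes>\<^bsub>?G\<^esub> z \<otimes>\<^bsub>?G\<^esub> y = inv\<^bsub>?G\<^esub> z"
    using conj_int_pow[OF _ _ dihedral_YY dihedral_YXY, of "int m"]
    by (simp add: y_def z_def dihedral_carrier int_pow_int int_pow_neg flip: dihedral_X_pow)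
  then have "y \<otimes>\<^bsub>?G\<^esub> z \<otimes>\<^bsub>?G\<^esub> y \<otimes>\<^bsub>?G\<^esub> y = z \<otimes>\<^bsub>?G\<^esub> y" by (simp add: inv_z)
  then have comm: "y \<otimes>\<^bsub>?G\<^esub> z = z \<otimes>\<^bsub>?G\<^esub> y" by (simp add: m_assoc yy)
  \<comment> \<open>Rewrite rules for right-nested products, with which \<open>simp\<close>
    evaluates all products in \<open>?H\<close>.\<close>
  have zl: "z \<otimes>\<^bsub>?G\<^esub> (z \<otimes>\<^bsub>?G\<^esub> g) = g" and yl: "y \<otimes>\<^bsub>?G\<^esub> (y \<otimes>\<^bsub>?G\<^esub> g) = g"
    and lcomm: "y \<otimes>\<^bsub>?G\<^esub> (z \<otimes>\<^bsub>?G\<^esub> g) = z \<otimes>\<^bsub>?G\<^esub> (y \<otimes>\<^bsub>?G\<^esub> g)" if "g \<in> carrier ?G" for g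
    using that by (simp_all add: zz yy comm flip: m_assoc)
  let ?H = "{\<one>\<^bsub>?G\<^esub>, z, y, z \<otimes>\<^bsub>?G\<^esub> y}"
  have H: "subgroup ?H ?G"
    by (rule subgroupI) (auto simp: inv_y inv_z inv_mult_group comm m_assoc zl yl lcomm yy zz)
  have sq: "b [^]\<^bsub>?G\<^esub> (2::nat) = \<one>\<^bsub>?G\<^esub>" if "b \<in> ?H" for b
    using that by (auto simp: numeral_2_eq_2 m_assoc zl yl lcomm comm yy zz)
  have ord_y: "ord y = 2" using yy y1 by (intro ord_eq_2) simp_all
  \<comment> \<open>The criterion is applied with \<open>a = y\<close>, whose order 2 annihilates
    \<open>?H\<close>.\<close>
  have "?H \<subseteq> generate ?G {y}"
  proof (rule subgroup_phi_sum_eq_order_iff[THEN iffD1, rule_format, OF _ eq H])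
    show "finite (carrier ?G)" by (rule finite_dihedral[OF assms(1)])
    show "b [^]\<^bsub>?G\<^esub> ord y = \<one>\<^bsub>?G\<^esub>" if "b \<in> ?H" for b
      unfolding ord_y by (rule sq[OF that])
  qed simp
  then have "card ?H \<le> ord y"
    using card_mono[OF finite_subset[OF generate_incl finite_dihedral[OF assms(1)]], of "{y}" ?H]
      generate_pow_card[of y] by simp
  \<comment> \<open>Three distinct elements already exceed the bound
    \<open>ord y = 2\<close>.\<close>
  moreover have "card {\<one>\<^bsub>?G\<^esub>, z, y} \<le> card ?H" by (rule card_mono) auto
  ultimately show False using ord_y z1 zy y1 by simp
qed

theorem theorem7:
  fixes n :: nat
  assumes "n \<ge> 2"
  shows "subgroup_phi_sum (dihedral_group n) = order (dihedral_group n) \<longleftrightarrow> odd n"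
proof
  assume "subgroup_phi_sum (dihedral_group n) = order (dihedral_group n)"
  then show "odd n" using dihedral_even_subgroup_phi_sum assms by force
next
  assume "odd n"
  then show "subgroup_phi_sum (dihedral_group n) = order (dihedral_group n)"
    using assms finite_dihedral[of n]
    by (intro group.dihedral_odd_subgroup_phi_sum[OF group_dihedral, where n = n
          and x = "dihedral_elt n [Gen X]" and y = "dihedral_elt n [Gen Y]"])
      (simp_all add: dihedral_carrier dihedral_X_pow_n dihedral_YY dihedral_YXY
        dihedral_normal_form)
qed

end
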